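(* Let $n\ge 2$, let $L$ be an order-$n$ Latin square, and for $a\ne b$ in $[n]$ let $$N_L(a,b)=\#\{(i,c): 1\le i\le n-1,\ 1\le c\le n,\ L(i,c)=a,\ L(i+1,c)=b\}$$ be the number of times $a$ sits immediately above $b$ in some column. Then for every permutation $\sigma$ of $[n]$, $$\Sigma(\sigma(L))=\sum_{\substack{a,b\in[n]\\ a\ne b}} N_L(a,b)\cdot\mathbf 1[\sigma(a)<\sigma(b)].$$
   Context: $[n]=\{1,\dots,n\}$. An order-$n$ Latin square is an $n\times n$ matrix $L=(L(i,j))_{1\le i,j\le n}$ with entries in $[n]$ such that every row and every column is a permutation of $[n]$. The total ascent statistic $\Sigma(L)$ is the total number of column ascents, i.e. the number of pairs $(i,j)$ with $1\le i\le n-1$, $1\le j\le n$ and $L(i,j)<L(i+1,j)$. For a permutation $\sigma$ of the symbol set $[n]$, $\sigma(L)$ is the Latin square with $\sigma(L)(i,j)=\sigma(L(i,j))$. $\mathbf 1[\cdot]$ is $1$ if the condition holds and $0$ otherwise; the sum is over ordered pairs $(a,b)$. *)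

theory Defs
  imports "HOL-Combinatorics.Permutations"
begin

text \<open>
  An \<open>n \<times> n\<close> matrix over \<open>{1..n}\<close> is a function \<open>L :: nat \<Rightarrow> nat \<Rightarrow> nat\<close>, row index first,
  of which only the values at indices in \<open>{1..n}\<close> are relevant.
\<close>

definition latin_square :: "nat \<Rightarrow> (nat \<Rightarrow> nat \<Rightarrow> nat) \<Rightarrow> bool" where
  "latin_square n L \<longleftrightarrow>
     (\<forall>i\<in>{1..n}. bij_betw (\<lambda>j. L i j) {1..n} {1..n}) \<and>
     (\<forall>j\<in>{1..n}. bij_betw (\<lambda>i. L i j) {1..n} {1..n})"

definition total_ascents :: "nat \<Rightarrow> (nat \<Rightarrow> nat \<Rightarrow> nat) \<Rightarrow> nat" where
  "total_ascents n L =
     card {(i, j). i \<in> {1..n - 1} \<and> j \<in> {1..n} \<and> L i j < L (i + 1) j}"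

definition relabel :: "(nat \<Rightarrow> nat) \<Rightarrow> (nat \<Rightarrow> nat \<Rightarrow> nat) \<Rightarrow> nat \<Rightarrow> nat \<Rightarrow> nat" where
  "relabel \<sigma> L = (\<lambda>i j. \<sigma> (L i j))"

definition vertical_adjacencies :: "nat \<Rightarrow> (nat \<Rightarrow> nat \<Rightarrow> nat) \<Rightarrow> nat \<Rightarrow> nat \<Rightarrow> nat" where
  "vertical_adjacencies n L a b =
     card {(i, c). i \<in> {1..n - 1} \<and> c \<in> {1..n} \<and> L i c = a \<and> L (i + 1) c = b}"

lemma latin_square_relabel:
  assumes "latin_square n L" and "\<sigma> permutes {1..n}"
  shows "latin_square n (relabel \<sigma> L)"
  using assms bij_betw_trans[OF _ permutes_imp_bij[OF assms(2)]]
  unfolding latin_square_def relabel_def by (fastforce simp: comp_def)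

end

theory Submission
  imports Defs
begin

text \<open>
  The identity is a double count. Group the positions of the column ascents of \<open>\<sigma>(L)\<close> by the
  ordered pair \<open>(a, b)\<close> of symbols that \<open>L\<close> itself has there, one immediately above the other.
  Whether such a position is an ascent of \<open>\<sigma>(L)\<close> depends only on this pair, through
  \<open>\<sigma> a < \<sigma> b\<close>; hence the class of \<open>(a, b)\<close> consists of all \<open>N\<^sub>L(a,b)\<close> occurrences of the pair or
  of none. Every class is indexed by a pair of distinct symbols of \<open>[n]\<close>, since
  \<open>\<sigma> a < \<sigma> b\<close> excludes \<open>a = b\<close>.
\<close>

lemma latin_square_entry:
  assumes "latin_square n L" "i \<in> {1..n}" "j \<in> {1..n}"
  shows "L i j \<in> {1..n}"
  using assms unfolding latin_square_def by (blast dest: bij_betwE)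

theorem theorem4p9:
  fixes n :: nat and L :: "nat \<Rightarrow> nat \<Rightarrow> nat" and \<sigma> :: "nat \<Rightarrow> nat"
  assumes "n \<ge> 2"
    and "latin_square n L"
    and "\<sigma> permutes {1..n}"
  shows "total_ascents n (relabel \<sigma> L) =
    (\<Sum>(a, b)\<in>{(a, b). a \<in> {1..n} \<and> b \<in> {1..n} \<and> a \<noteq> b}.
       vertical_adjacencies n L a b * of_bool (\<sigma> a < \<sigma> b))"
proof -
  define A where "A = {(i, j). i \<in> {1..n - 1} \<and> j \<in> {1..n} \<and> \<sigma> (L i j) < \<sigma> (L (i + 1) j)}"
  define P where "P = {(a, b). a \<in> {1..n} \<and> b \<in> {1..n} \<and> a \<noteq> b}"
  define pair where "pair = (\<lambda>(i, j). (L i j, L (i + 1) j))"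
  have "finite A"
    by (rule finite_subset[of _ "{1..n - 1} \<times> {1..n}"]) (auto simp: A_def)
  have "finite P"
    by (rule finite_subset[of _ "{1..n} \<times> {1..n}"]) (auto simp: P_def)
  have "pair ` A \<subseteq> P"
  proof (rule image_subsetI)
    fix x assume "x \<in> A"
    then obtain i j where x: "x = (i, j)" and "i \<in> {1..n}" "i + 1 \<in> {1..n}" "j \<in> {1..n}" "L i j \<noteq> L (i + 1) j"
      by (fastforce simp: A_def)
    then show "pair x \<in> P"
      using latin_square_entry[OF assms(2)] by (simp add: pair_def P_def del: atLeastAtMost_iff)
  qed
  have fiber: "card {x \<in> A. pair x = (a, b)} =
      vertical_adjacencies n L a b * of_bool (\<sigma> a < \<sigma> b)" for a b
  proof (cases "\<sigma> a < \<sigma> b")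
    case True
    then have "{x \<in> A. pair x = (a, b)} =
        {(i, c). i \<in> {1..n - 1} \<and> c \<in> {1..n} \<and> L i c = a \<and> L (i + 1) c = b}"
      by (auto simp: A_def pair_def)
    with True show ?thesis by (simp add: vertical_adjacencies_def)
  next
    case False
    then have "{x \<in> A. pair x = (a, b)} = {}"
      by (auto simp: A_def pair_def)
    then show ?thesis using False by (simp only: card.empty) simp
  qed
  have "total_ascents n (relabel \<sigma> L) = card A"
    by (simp add: total_ascents_def relabel_def A_def)
  also have "\<dots> = (\<Sum>p\<in>P. card {x \<in> A. pair x = p})"
    using sum.group[OF \<open>finite A\<close> \<open>finite P\<close> \<open>pair ` A \<subseteq> P\<close>, of "\<lambda>_. 1::nat"] by simp
  also have "\<dots> = (\<Sum>(a, b)\<in>P. vertical_adjacencies n L a b * of_bool (\<sigma> a < \<sigma> b))"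
    by (rule sum.cong) (auto simp: fiber)
  finally show ?thesis by (simp only: P_def)
qed

end
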